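(* Let $(E,\tau)$ be a locally solid vector lattice with an order bounded zero neighborhood. Then the product (composition) of $ob$-bounded operators $(S,T)\mapsto S\circ T$ is continuous in $B_{ob}(E)$ with respect to the topology of uniform convergence on order bounded sets.
   Context: All vector spaces are real and operators are linear. A locally solid vector lattice $(E,\tau)$ is a vector lattice $E$ with a linear topology $\tau$ having a base at zero consisting of solid sets. A subset of a vector lattice is order bounded if it is contained in an order interval $[-a,a]=\{x:-a\le x\le a\}$ for some $a\ge 0$. A subset $B\subseteq E$ is ($\tau$-)bounded if for each zero neighborhood $U$ there is a scalar $\lambda>0$ with $B\subseteq\lambda U$. An operator $T:E\to E$ is $ob$-bounded if $T(B)$ is $\tau$-bounded for every order bounded set $B\subseteq E$. $B_{ob}(E)$ denotes the set of all $ob$-bounded operators from $E$ to $E$. A net $(S_\alpha)$ in $B_{ob}(E)$ converges to zero uniformly on an order bounded set $B\subseteq E$ if for each zero neighborhood $V$ in $E$ there is an index $\alpha_0$ such that $S_\alpha(B)\subseteq V$ for all $\alpha\ge\alpha_0$. The net $(S_\alpha)$ converges to $S$ uniformly on order bounded sets if $(S_\alpha-S)$ converges to zero uniformly on every order bounded set. The topology of uniform convergence on order bounded sets is the one with this net convergence; continuity of an operation means that it preserves convergence of nets. *)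

theory Defs
  imports Complex_Main
begin

class vector_lattice = ordered_real_vector + lattice

definition (in vector_lattice) modulus :: "'a \<Rightarrow> 'a" where
  "modulus x = sup x (- x)"

definition (in vector_lattice) solid :: "'a set \<Rightarrow> bool" where
  "solid A \<longleftrightarrow> (\<forall>x\<in>A. \<forall>y. modulus y \<le> modulus x \<longrightarrow> y \<in> A)"

definition order_bounded :: "'a::vector_lattice set \<Rightarrow> bool" where
  "order_bounded A \<longleftrightarrow> (\<exists>a\<ge>0. A \<subseteq> {- a..a})"

text \<open>The topology is not assumed to be Hausdorff.\<close>

class topological_vector_lattice = vector_lattice + topological_ab_group_add +
  assumes tendsto_scaleR_nhds:
    "filterlim (\<lambda>p. fst p *\<^sub>R snd p) (nhds (c *\<^sub>R x)) (nhds (c::real) \<times>\<^sub>F nhds x)"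

text \<open>A zero neighborhood need not be open.\<close>

definition (in topological_vector_lattice) zero_nhd :: "'a set \<Rightarrow> bool" where
  "zero_nhd U \<longleftrightarrow> (\<exists>W. open W \<and> 0 \<in> W \<and> W \<subseteq> U)"

class locally_solid_vector_lattice = topological_vector_lattice +
  assumes solid_base:
    "zero_nhd U \<Longrightarrow> \<exists>V. zero_nhd V \<and> solid V \<and> V \<subseteq> U"

definition top_bounded :: "'a::locally_solid_vector_lattice set \<Rightarrow> bool" where
  "top_bounded B \<longleftrightarrow> (\<forall>U. zero_nhd U \<longrightarrow> (\<exists>c::real. c > 0 \<and> B \<subseteq> (\<lambda>x. c *\<^sub>R x) ` U))"

definition B_ob :: "('a::locally_solid_vector_lattice \<Rightarrow> 'a) set" where
  "B_ob = {T. linear T \<and> (\<forall>B. order_bounded B \<longrightarrow> top_bounded (T ` B))}"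

text \<open>
  The index set of a net is given as a carrier \<open>I\<close> with a relation \<open>le\<close>, where \<open>le i j\<close> reads
  \<open>j\<close> is at or beyond \<open>i\<close>; only the restriction of \<open>le\<close> to \<open>I\<close> matters, and antisymmetry is
  not required.
\<close>

definition directed_set :: "'i set \<Rightarrow> ('i \<Rightarrow> 'i \<Rightarrow> bool) \<Rightarrow> bool" where
  "directed_set I le \<longleftrightarrow> I \<noteq> {} \<and> (\<forall>i\<in>I. le i i) \<and>
     (\<forall>i\<in>I. \<forall>j\<in>I. \<forall>k\<in>I. le i j \<longrightarrow> le j k \<longrightarrow> le i k) \<and>
     (\<forall>i\<in>I. \<forall>j\<in>I. \<exists>k\<in>I. le i k \<and> le j k)"

definition null_uniformly_on ::
    "'i set \<Rightarrow> ('i \<Rightarrow> 'i \<Rightarrow> bool) \<Rightarrow> ('i \<Rightarrow> 'a \<Rightarrow> 'a) \<Rightarrow> 'a::locally_solid_vector_lattice set \<Rightarrow> bool"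
  where
  "null_uniformly_on I le S B \<longleftrightarrow>
     (\<forall>V. zero_nhd V \<longrightarrow> (\<exists>i0\<in>I. \<forall>i\<in>I. le i0 i \<longrightarrow> S i ` B \<subseteq> V))"

definition ob_converges ::
    "'i set \<Rightarrow> ('i \<Rightarrow> 'i \<Rightarrow> bool) \<Rightarrow> ('i \<Rightarrow> 'a \<Rightarrow> 'a) \<Rightarrow> ('a::locally_solid_vector_lattice \<Rightarrow> 'a) \<Rightarrow> bool"
  where
  "ob_converges I le S S0 \<longleftrightarrow>
     (\<forall>B. order_bounded B \<longrightarrow> null_uniformly_on I le (\<lambda>i x. S i x - S0 x) B)"

end

theory Submission
  imports Defs
begin

text \<open>
  An order bounded zero neighborhood \<open>U\<close> makes every topologically bounded set order bounded.
  Hence \<open>S \<circ> T\<close> is again ob-bounded, and in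
  \<open>S\<^sub>i T\<^sub>i - S\<^sub>0 T\<^sub>0 = (S\<^sub>i - S\<^sub>0) (T\<^sub>i - T\<^sub>0) + (S\<^sub>i - S\<^sub>0) T\<^sub>0 + S\<^sub>0 (T\<^sub>i - T\<^sub>0)\<close>
  all three terms are uniformly small on an order bounded set \<open>B\<close>: in the first, \<open>T\<^sub>i - T\<^sub>0\<close>
  eventually maps \<open>B\<close> into \<open>U\<close>; in the second, \<open>T\<^sub>0 B\<close> is order bounded; in the third,
  \<open>S\<^sub>0\<close> maps a small multiple of \<open>U\<close> into any given zero neighborhood.
\<close>

text \<open>Restating \<open>zero_nhd\<close> through the filter \<open>nhds 0\<close> lets
  continuity of the vector operations, which is given as limits, produce zero neighborhoods.\<close>

lemma zero_nhd_iff_eventually: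
  fixes U :: "'a::topological_vector_lattice set"
  shows "zero_nhd U \<longleftrightarrow> eventually (\<lambda>x. x \<in> U) (nhds 0)"
  unfolding zero_nhd_def eventually_nhds by blast

lemma zero_nhd_scaleR_preimage:
  fixes U :: "'a::topological_vector_lattice set"
  assumes "zero_nhd U"
  shows "zero_nhd {x. c *\<^sub>R x \<in> U}"
proof -
  \<comment> \<open>Joint continuity of scalar multiplication at \<open>(c, 0)\<close> is restricted
    to the slice with first coordinate \<open>c\<close>.\<close>
  have "filterlim (\<lambda>x::'a. (c, x)) (nhds c \<times>\<^sub>F nhds 0) (nhds 0)"
    by (intro filterlim_Pair tendsto_const filterlim_ident)
  from filterlim_compose[OF tendsto_scaleR_nhds this]
  have "filterlim (\<lambda>x::'a. c *\<^sub>R x) (nhds 0) (nhds 0)"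
    by simp
  then show ?thesis
    using assms unfolding zero_nhd_iff_eventually filterlim_iff
    by (elim allE[of _ "\<lambda>x. x \<in> U"]) simp
qed

text \<open>This is continuity of addition at \<open>(0, 0)\<close>; a single \<open>V\<close>
  serves both summands because both factors of the product filter are \<open>nhds 0\<close>.\<close>

lemma zero_nhd_add_split:
  fixes U :: "'a::topological_vector_lattice set"
  assumes "zero_nhd U"
  obtains V where "zero_nhd V" "\<And>x y. x \<in> V \<Longrightarrow> y \<in> V \<Longrightarrow> x + y \<in> U"
proof -
  have "filterlim (\<lambda>p::'a \<times> 'a. fst p + snd p) (nhds 0) (nhds 0 \<times>\<^sub>F nhds 0)"
    using tendsto_add_Pair[of "0::'a" 0] by simp
  then have "eventually (\<lambda>p. fst p + snd p \<in> U) (nhds 0 \<times>\<^sub>F nhds 0)"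
    using assms unfolding zero_nhd_iff_eventually filterlim_iff by blast
  then obtain P where "eventually P (nhds 0)" "\<And>x y. P x \<Longrightarrow> P y \<Longrightarrow> x + y \<in> U"
    unfolding eventually_prod_same by auto
  then show thesis
    by (intro that[of "{x. P x}"]) (auto simp: zero_nhd_iff_eventually)
qed

lemma order_bounded_subset: "order_bounded A \<Longrightarrow> B \<subseteq> A \<Longrightarrow> order_bounded B"
  unfolding order_bounded_def by blast

lemma order_bounded_scaleR:
  assumes "order_bounded A" "c \<ge> 0"
  shows "order_bounded ((\<lambda>x. c *\<^sub>R x) ` A)"
proof -
  from assms(1) obtain a where a: "a \<ge> 0" "A \<subseteq> {- a..a}"
    unfolding order_bounded_def by blast
  have "(\<lambda>x. c *\<^sub>R x) ` A \<subseteq> {- (c *\<^sub>R a)..c *\<^sub>R a}"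
    using a(2) \<open>c \<ge> 0\<close>
    by (auto simp flip: scaleR_minus_right intro!: scaleR_left_mono)
  moreover have "c *\<^sub>R a \<ge> 0"
    using a(1) \<open>c \<ge> 0\<close> by (rule scaleR_nonneg_nonneg[rotated])
  ultimately show ?thesis
    unfolding order_bounded_def by blast
qed

text \<open>\<open>B\<close> lies in a positive multiple of \<open>U\<close>, and such multiples
  inherit an order bound from \<open>U\<close>.\<close>

lemma top_bounded_imp_order_bounded:
  fixes U B :: "'a::locally_solid_vector_lattice set"
  assumes "zero_nhd U" "order_bounded U" "top_bounded B"
  shows "order_bounded B"
proof -
  obtain c :: real where "c > 0" "B \<subseteq> (\<lambda>x. c *\<^sub>R x) ` U"
    using assms(1,3) unfolding top_bounded_def by blast
  then show ?thesis
    using order_bounded_subset order_bounded_scaleR[OF assms(2)] by (meson less_imp_le)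
qed

lemma B_ob_image_order_bounded:
  fixes T :: "'a::locally_solid_vector_lattice \<Rightarrow> 'a" and U :: "'a set"
  assumes "zero_nhd U" "order_bounded U" "T \<in> B_ob" "order_bounded B"
  shows "order_bounded (T ` B)"
  using assms top_bounded_imp_order_bounded unfolding B_ob_def by blast

text \<open>\<open>T\<close> maps order bounded sets to order bounded sets, so the ob-boundedness of
  \<open>S\<close> applies to the image.\<close>

lemma B_ob_comp:
  fixes S :: "'a::locally_solid_vector_lattice \<Rightarrow> 'a" and U :: "'a set"
  assumes "zero_nhd U" "order_bounded U" "S \<in> B_ob" "T \<in> B_ob"
  shows "S \<circ> T \<in> B_ob"
proof -
  have "top_bounded ((S \<circ> T) ` B)" if "order_bounded B" for B
    using B_ob_image_order_bounded[OF assms(1,2,4) that] assms(3)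
    unfolding B_ob_def image_comp[symmetric] by blast
  then show ?thesis
    using assms(3,4) unfolding B_ob_def by (simp add: linear_compose)
qed

lemma null_uniformly_on_add:
  fixes F G :: "'i \<Rightarrow> 'a::locally_solid_vector_lattice \<Rightarrow> 'a"
  assumes "directed_set I le" "null_uniformly_on I le F B" "null_uniformly_on I le G B"
  shows "null_uniformly_on I le (\<lambda>i x. F i x + G i x) B"
  unfolding null_uniformly_on_def
proof (intro allI impI)
  fix W :: "'a set"
  assume "zero_nhd W"
  then obtain V where V: "zero_nhd V" "\<And>x y. x \<in> V \<Longrightarrow> y \<in> V \<Longrightarrow> x + y \<in> W"
    using zero_nhd_add_split by blast
  obtain i j where i: "i \<in> I" "\<And>k. k \<in> I \<Longrightarrow> le i k \<Longrightarrow> F k ` B \<subseteq> V"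
    and j: "j \<in> I" "\<And>k. k \<in> I \<Longrightarrow> le j k \<Longrightarrow> G k ` B \<subseteq> V"
    using assms(2,3) V(1) unfolding null_uniformly_on_def by meson
  obtain m where m: "m \<in> I" "le i m" "le j m"
    using assms(1) i(1) j(1) unfolding directed_set_def by blast
  have "(\<lambda>x. F k x + G k x) ` B \<subseteq> W" if "k \<in> I" "le m k" for k
  proof -
    have "le i k" "le j k"
      using assms(1) i(1) j(1) m that unfolding directed_set_def by blast+
    then show ?thesis
      using i(2) j(2) V(2) that(1) by blast
  qed
  with m(1) show "\<exists>i0\<in>I. \<forall>k\<in>I. le i0 k \<longrightarrow> (\<lambda>x. F k x + G k x) ` B \<subseteq> W"
    by blast
qed

text \<open>Eventually \<open>G\<close> sends \<open>B\<close> into the fixed set \<open>U\<close>,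
  on which \<open>F\<close> is eventually small; directedness supplies an index beyond both
  thresholds.\<close>

lemma null_uniformly_on_comp:
  fixes F G :: "'i \<Rightarrow> 'a::locally_solid_vector_lattice \<Rightarrow> 'a"
  assumes "directed_set I le" "zero_nhd U"
    and "null_uniformly_on I le F U" "null_uniformly_on I le G B"
  shows "null_uniformly_on I le (\<lambda>i x. F i (G i x)) B"
  unfolding null_uniformly_on_def
proof (intro allI impI)
  fix V :: "'a set"
  assume "zero_nhd V"
  then obtain i j where i: "i \<in> I" "\<And>k. k \<in> I \<Longrightarrow> le i k \<Longrightarrow> F k ` U \<subseteq> V"
    and j: "j \<in> I" "\<And>k. k \<in> I \<Longrightarrow> le j k \<Longrightarrow> G k ` B \<subseteq> U"
    using assms(2-4) unfolding null_uniformly_on_def by meson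
  obtain m where m: "m \<in> I" "le i m" "le j m"
    using assms(1) i(1) j(1) unfolding directed_set_def by blast
  have "(\<lambda>x. F k (G k x)) ` B \<subseteq> V" if "k \<in> I" "le m k" for k
  proof -
    have "le i k" "le j k"
      using assms(1) i(1) j(1) m that unfolding directed_set_def by blast+
    then show ?thesis
      using i(2) j(2) that(1) by blast
  qed
  with m(1) show "\<exists>i0\<in>I. \<forall>k\<in>I. le i0 k \<longrightarrow> (\<lambda>x. F k (G k x)) ` B \<subseteq> V"
    by blast
qed

lemma null_uniformly_on_image:
  "null_uniformly_on I le F (T ` B) \<Longrightarrow> null_uniformly_on I le (\<lambda>i x. F i (T x)) B"
  unfolding null_uniformly_on_def by (simp add: image_image)

text \<open>An ob-bounded operator is continuous at zero here: \<open>S\<close> maps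
  \<open>U\<close> into some \<open>c *\<^sub>R V\<close>, hence by homogeneity the multiple of
  \<open>U\<close> by \<open>1 / c\<close> into \<open>V\<close>.\<close>

lemma B_ob_zero_nhd_preimage:
  fixes S :: "'a::locally_solid_vector_lattice \<Rightarrow> 'a" and U :: "'a set"
  assumes "zero_nhd U" "order_bounded U" "S \<in> B_ob" "zero_nhd V"
  shows "zero_nhd (S -` V)"
proof -
  have S: "linear S" "top_bounded (S ` U)"
    using assms(2,3) unfolding B_ob_def by auto
  obtain c :: real where c: "c > 0" "S ` U \<subseteq> (\<lambda>x. c *\<^sub>R x) ` V"
    using S(2) assms(4) unfolding top_bounded_def by blast
  \<comment> \<open>Since \<open>c > 0\<close>, the left side is \<open>U\<close> scaled by
    \<open>1 / c\<close>.\<close>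
  have "{x. c *\<^sub>R x \<in> U} \<subseteq> S -` V"
  proof
    fix x
    assume "x \<in> {x. c *\<^sub>R x \<in> U}"
    then obtain v where "v \<in> V" "S (c *\<^sub>R x) = c *\<^sub>R v"
      using c(2) by blast
    then show "x \<in> S -` V"
      using c(1) by (simp add: linear_scale[OF S(1)])
  qed
  moreover have "zero_nhd {x. c *\<^sub>R x \<in> U}"
    using assms(1) by (rule zero_nhd_scaleR_preimage)
  ultimately show ?thesis
    unfolding zero_nhd_def by blast
qed

lemma null_uniformly_on_B_ob_comp:
  fixes S :: "'a::locally_solid_vector_lattice \<Rightarrow> 'a" and U :: "'a set"
  assumes "zero_nhd U" "order_bounded U" "S \<in> B_ob" "null_uniformly_on I le F B"
  shows "null_uniformly_on I le (\<lambda>i x. S (F i x)) B"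
  unfolding null_uniformly_on_def
proof (intro allI impI)
  fix V :: "'a set"
  assume "zero_nhd V"
  then have "zero_nhd (S -` V)"
    using B_ob_zero_nhd_preimage assms(1-3) by blast
  then obtain i0 where "i0 \<in> I" "\<forall>i\<in>I. le i0 i \<longrightarrow> F i ` B \<subseteq> S -` V"
    using assms(4) unfolding null_uniformly_on_def by blast
  then show "\<exists>i0\<in>I. \<forall>i\<in>I. le i0 i \<longrightarrow> (\<lambda>x. S (F i x)) ` B \<subseteq> V"
    by (intro bexI[of _ i0]) auto
qed

text \<open>Agreement is asked for on \<open>I\<close> alone because the members of a net are known
  to be linear only at indices in \<open>I\<close>.\<close>

lemma null_uniformly_on_cong:
  assumes "\<And>i x. i \<in> I \<Longrightarrow> x \<in> B \<Longrightarrow> F i x = G i x"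
  shows "null_uniformly_on I le F B \<longleftrightarrow> null_uniformly_on I le G B"
proof -
  have "F i ` B = G i ` B" if "i \<in> I" for i
    using assms that by (intro image_cong) auto
  then show ?thesis
    unfolding null_uniformly_on_def by simp
qed

lemma ob_converges_comp:
  fixes S0 :: "'a::locally_solid_vector_lattice \<Rightarrow> 'a" and U :: "'a set"
  assumes U: "zero_nhd U" "order_bounded U"
    and dir: "directed_set I le"
    and lin: "\<And>i. i \<in> I \<Longrightarrow> linear (S i)"
    and S0: "S0 \<in> B_ob" and T0: "T0 \<in> B_ob"
    and S: "ob_converges I le S S0" and T: "ob_converges I le T T0"
  shows "ob_converges I le (\<lambda>i. S i \<circ> T i) (S0 \<circ> T0)"
  unfolding ob_converges_def
proof (intro allI impI)
  fix B :: "'a set"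
  assume B: "order_bounded B"
  let ?D = "\<lambda>i x. S i x - S0 x" and ?E = "\<lambda>i x. T i x - T0 x"
  have E: "null_uniformly_on I le ?E B"
    using T B unfolding ob_converges_def by blast
  have D: "null_uniformly_on I le ?D C" if "order_bounded C" for C
    using S that unfolding ob_converges_def by blast
  \<comment> \<open>\<open>U\<close> plays both roles: as a zero neighborhood it eventually absorbs
    the values of \<open>?E\<close> on \<open>B\<close>, and as an order bounded set it is one on
    which \<open>?D\<close> tends uniformly to zero.\<close>
  have "null_uniformly_on I le (\<lambda>i x. ?D i (?E i x)) B"
    using dir U(1) D[OF U(2)] E by (rule null_uniformly_on_comp)
  moreover have "null_uniformly_on I le (\<lambda>i x. ?D i (T0 x)) B"
    using D[OF B_ob_image_order_bounded[OF U T0 B]] by (rule null_uniformly_on_image)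
  moreover have "null_uniformly_on I le (\<lambda>i x. S0 (?E i x)) B"
    using null_uniformly_on_B_ob_comp[OF U S0 E] .
  ultimately have
    "null_uniformly_on I le (\<lambda>i x. ?D i (?E i x) + ?D i (T0 x) + S0 (?E i x)) B"
    by (intro null_uniformly_on_add[OF dir])
  \<comment> \<open>Linearity of \<open>S i\<close> and \<open>S0\<close> splits their values at
    \<open>T i x - T0 x\<close>, after which the mixed terms cancel.\<close>
  moreover have "?D i (?E i x) + ?D i (T0 x) + S0 (?E i x) = (S i \<circ> T i) x - (S0 \<circ> T0) x"
    if "i \<in> I" for i x
    using S0 by (simp add: B_ob_def linear_diff lin[OF that] algebra_simps)
  ultimately show "null_uniformly_on I le (\<lambda>i x. (S i \<circ> T i) x - (S0 \<circ> T0) x) B"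
    by (rule null_uniformly_on_cong[THEN iffD1, rotated])
qed

theorem theorem2p3:
  assumes "\<exists>U::'a::locally_solid_vector_lattice set. zero_nhd U \<and> order_bounded U"
  shows "(\<forall>S\<in>B_ob. \<forall>T\<in>B_ob. S \<circ> T \<in> (B_ob :: ('a \<Rightarrow> 'a) set)) \<and>
    (\<forall>(I :: 'i set) le (S :: 'i \<Rightarrow> 'a \<Rightarrow> 'a) T S0 T0.
       directed_set I le \<longrightarrow>
       (\<forall>i\<in>I. S i \<in> B_ob) \<longrightarrow> (\<forall>i\<in>I. T i \<in> B_ob) \<longrightarrow> S0 \<in> B_ob \<longrightarrow> T0 \<in> B_ob \<longrightarrow>
       ob_converges I le S S0 \<longrightarrow> ob_converges I le T T0 \<longrightarrow>
       ob_converges I le (\<lambda>i. S i \<circ> T i) (S0 \<circ> T0))"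
proof -
  obtain U :: "'a set" where U: "zero_nhd U" "order_bounded U"
    using assms by blast
  have "linear S" if "S \<in> B_ob" for S :: "'a \<Rightarrow> 'a"
    using that by (simp add: B_ob_def)
  then show ?thesis
    using B_ob_comp[OF U] by (intro conjI ballI allI impI ob_converges_comp[OF U]) auto
qed

end
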